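(* Let $L$ be a continuous conditionally-complete distributive lattice, let $E$ be a quasisober topological space with Borel $\sigma$-algebra $\mathcal{B}$, and let $\nu:\mathcal{B}\to L$ be an $L$-valued maxitive measure. Then there exists a least $L$-valued maxitive measure $\bot\nu$ on $\mathcal{B}$ (called the singular part of $\nu$) such that $$\nu^{+} = \lfloor \nu \rfloor \oplus \bot\nu .$$ Moreover, $\bot\nu([x]) = 0$ for all $x \in E$, and the singular part of the regular part of $\nu$ equals $0$, i.e. $\bot\lfloor\nu\rfloor = 0$.
   Context: Order theory. $\bigoplus$, $\oplus$ denote suprema, $\bigwedge$ infima. A lattice is a poset in which every nonempty finite subset has a supremum and an infimum; it is conditionally-complete if every nonempty subset bounded above has a supremum; it is distributive if finite infima distribute over finite suprema. A filter in a poset is a nonempty upper set $F$ in which any two elements have a lower bound in $F$. $s \gg r$ means: for every filter $F$ having an infimum, $r \geqslant \bigwedge F$ implies $s\in F$. A poset $L$ is continuous if for every $r\in L$ the set $\{s : s\gg r\}$ is a filter with infimum $r$. $L$ is assumed to have a bottom element $0$ (so every filter of $L$ has an infimum). Topology. $\mathcal{G}$ is the collection of open subsets of $E$. A subset is irreducible if it is nonempty and whenever it is contained in the union of two closed sets it is contained in one of them; $E$ is quasisober if every irreducible closed subset is the closure of a singleton. A subset is saturated if it is an intersection of open subsets; $\uparrow\! x$ is the intersection of all open subsets containing $x$. Compact does not require Hausdorff. $\mathcal{B}$ is the $\sigma$-algebra generated by the open subsets and the compact saturated subsets. $\mathcal{K}$ is the collection of compact subsets belonging to $\mathcal{B}$.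 $[x] := \uparrow\! x \cap \overline{\{x\}}$, which belongs to $\mathcal{K}$. Maxitive measures. A maxitive measure is a map $\nu:\mathcal{B}\to L$ with $\nu(\emptyset)=0$ and $\nu(B_1\cup B_2)=\nu(B_1)\oplus\nu(B_2)$ for all $B_1,B_2\in\mathcal{B}$. Maxitive measures are ordered pointwise and $\oplus$ of maps is taken pointwise. $\nu^{+}(B) := \bigwedge_{G\in\mathcal{G}, G\supset B}\nu(G)$ for $B \in \mathcal{B}$. The regular part of $\nu$ is the map $\lfloor\nu\rfloor(B) := \bigoplus_{K\in\mathcal{K}, K\subset B}\nu^{+}(K)$, $B\in\mathcal{B}$ (it is a maxitive measure under the present assumptions). *)

theory Defs
  imports "HOL-Analysis.Abstract_Topology" "HOL-Analysis.Sigma_Algebra"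
begin

text \<open>
  The lattice \<open>L\<close> is a type \<open>'l\<close> of sort
  \<open>{conditionally_complete_lattice, distrib_lattice, order_bot}\<close>; its bottom element \<open>bot\<close> is
  the 0 of \<open>L\<close>. The space \<open>E\<close> is a \<open>'e topology\<close>. Maxitive measures are total functions on
  \<open>'e set\<close>; only their values on the Borel sets matter, so equality and order between them are
  always restricted to Borel sets.
\<close>

subsection \<open>Continuous posets\<close>

definition poset_filter :: "'l::order set \<Rightarrow> bool" where
  "poset_filter F \<longleftrightarrow> F \<noteq> {} \<and> (\<forall>x\<in>F. \<forall>y. x \<le> y \<longrightarrow> y \<in> F) \<and>
     (\<forall>x\<in>F. \<forall>y\<in>F. \<exists>z\<in>F. z \<le> x \<and> z \<le> y)"

text \<open>Because of the bottom element, every filter has an infimum, which is \<open>Inf F\<close>.\<close>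

definition way_above :: "'l::{conditionally_complete_lattice, order_bot} \<Rightarrow> 'l \<Rightarrow> bool" where
  "way_above s r \<longleftrightarrow> (\<forall>F. poset_filter F \<longrightarrow> Inf F \<le> r \<longrightarrow> s \<in> F)"

definition continuous_poset :: "'l::{conditionally_complete_lattice, order_bot} itself \<Rightarrow> bool" where
  "continuous_poset _ \<longleftrightarrow>
     (\<forall>r::'l. poset_filter {s. way_above s r} \<and> Inf {s. way_above s r} = r)"

subsection \<open>Topology\<close>

definition irreducible_in :: "'e topology \<Rightarrow> 'e set \<Rightarrow> bool" where
  "irreducible_in X S \<longleftrightarrow> S \<subseteq> topspace X \<and> S \<noteq> {} \<and>
     (\<forall>C D. closedin X C \<longrightarrow> closedin X D \<longrightarrow> S \<subseteq> C \<union> D \<longrightarrow> S \<subseteq> C \<or> S \<subseteq> D)"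

definition quasisober :: "'e topology \<Rightarrow> bool" where
  "quasisober X \<longleftrightarrow>
     (\<forall>C. closedin X C \<longrightarrow> irreducible_in X C \<longrightarrow> (\<exists>x\<in>topspace X. C = X closure_of {x}))"

text \<open>The family is required to be nonempty because the empty intersection would be \<open>UNIV\<close>
  instead of \<open>topspace X\<close>; nothing is lost, as \<open>topspace X\<close> is itself open.\<close>

definition saturated_in :: "'e topology \<Rightarrow> 'e set \<Rightarrow> bool" where
  "saturated_in X S \<longleftrightarrow> (\<exists>\<U>. \<U> \<noteq> {} \<and> (\<forall>U\<in>\<U>. openin X U) \<and> S = \<Inter>\<U>)"

definition up_point :: "'e topology \<Rightarrow> 'e \<Rightarrow> 'e set" where
  "up_point X x = \<Inter>{U. openin X U \<and> x \<in> U}"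

definition point_class :: "'e topology \<Rightarrow> 'e \<Rightarrow> 'e set" where
  "point_class X x = up_point X x \<inter> X closure_of {x}"

definition borel_sets :: "'e topology \<Rightarrow> 'e set set" where
  "borel_sets X =
     sigma_sets (topspace X) ({G. openin X G} \<union> {K. compactin X K \<and> saturated_in X K})"

definition compact_borel_sets :: "'e topology \<Rightarrow> 'e set set" where
  "compact_borel_sets X = {K \<in> borel_sets X. compactin X K}"

subsection \<open>Maxitive measures\<close>

definition maxitive_measure ::
  "'e topology \<Rightarrow> ('e set \<Rightarrow> 'l::{conditionally_complete_lattice, order_bot}) \<Rightarrow> bool" where
  "maxitive_measure X \<nu> \<longleftrightarrow> \<nu> {} = bot \<and>
     (\<forall>B1\<in>borel_sets X. \<forall>B2\<in>borel_sets X. \<nu> (B1 \<union> B2) = sup (\<nu> B1) (\<nu> B2))"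

text \<open>For maxitive \<open>\<nu>\<close> the infimum and the supremum below exist: the indexing families
  contain \<open>topspace X\<close> and \<open>{}\<close> respectively, and all values lie between \<open>bot\<close> and
  \<open>\<nu> (topspace X)\<close>.\<close>

definition outer_part ::
  "'e topology \<Rightarrow> ('e set \<Rightarrow> 'l::{conditionally_complete_lattice, order_bot}) \<Rightarrow> 'e set \<Rightarrow> 'l" where
  "outer_part X \<nu> B = (INF G\<in>{G. openin X G \<and> B \<subseteq> G}. \<nu> G)"

definition regular_part ::
  "'e topology \<Rightarrow> ('e set \<Rightarrow> 'l::{conditionally_complete_lattice, order_bot}) \<Rightarrow> 'e set \<Rightarrow> 'l" where
  "regular_part X \<nu> B = (SUP K\<in>{K \<in> compact_borel_sets X. K \<subseteq> B}. outer_part X \<nu> K)"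

definition singular_complement ::
  "'e topology \<Rightarrow> ('e set \<Rightarrow> 'l::{conditionally_complete_lattice, order_bot}) \<Rightarrow> ('e set \<Rightarrow> 'l) \<Rightarrow> bool"
  where
  "singular_complement X \<nu> \<tau> \<longleftrightarrow> maxitive_measure X \<tau> \<and>
     (\<forall>B\<in>borel_sets X. outer_part X \<nu> B = sup (regular_part X \<nu> B) (\<tau> B))"

text \<open>\<open>is_singular_part X \<nu> \<tau>\<close> says that \<open>\<nu>\<close> is a maxitive measure whose singular part exists
  and is \<open>\<tau>\<close>; the values of such a \<open>\<tau>\<close> on Borel sets are uniquely determined.\<close>

definition is_singular_part ::
  "'e topology \<Rightarrow> ('e set \<Rightarrow> 'l::{conditionally_complete_lattice, order_bot}) \<Rightarrow> ('e set \<Rightarrow> 'l) \<Rightarrow> bool"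
  where
  "is_singular_part X \<nu> \<tau> \<longleftrightarrow> maxitive_measure X \<nu> \<and> singular_complement X \<nu> \<tau> \<and>
     (\<forall>\<tau>'. singular_complement X \<nu> \<tau>' \<longrightarrow> (\<forall>B\<in>borel_sets X. \<tau> B \<le> \<tau>' B))"

end

theory Submission
  imports Defs
begin

text \<open>
  Write \<open>c x = \<nu>\<^sup>+ {x}\<close>. If \<open>s\<close> is way above an upper bound of \<open>c\<close> on \<open>B\<close>, then every point
  of \<open>B\<close> has an open neighbourhood \<open>G\<close> with \<open>\<nu> G \<le> s\<close>. For compact \<open>B\<close> finitely many of these
  cover \<open>B\<close>, so \<open>\<nu>\<^sup>+ B\<close> is the supremum of \<open>c\<close> over \<open>B\<close>; hence the regular part of \<open>\<nu>\<close>
  at any Borel set \<open>B\<close> is the supremum of \<open>c\<close> over \<open>B\<close>. This makes the regular part maxitive, and the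
  union of all the neighbourhoods shows that its outer part coincides with its own regular part.

  The singular part of \<open>\<nu>\<close> at \<open>B\<close> is the infimum of all \<open>t\<close> with
  \<open>\<nu>\<^sup>+ A \<le> \<lfloor>\<nu>\<rfloor> A \<oplus> t\<close> for every Borel \<open>A \<subseteq> B\<close>. By distributivity these \<open>t\<close> form a filter, and
  continuity then yields that the infimum is attained.
\<close>

subsection \<open>The way-above relation\<close>

lemma poset_filterI:
  assumes "a \<in> F" and "\<And>x y. x \<in> F \<Longrightarrow> x \<le> y \<Longrightarrow> y \<in> F"
    and "\<And>x y. x \<in> F \<Longrightarrow> y \<in> F \<Longrightarrow> \<exists>z\<in>F. z \<le> x \<and> z \<le> y"
  shows "poset_filter F"
  using assms unfolding poset_filter_def by blast

lemma way_above_imp_le: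
  fixes r s :: "'l::{conditionally_complete_lattice, order_bot}"
  assumes "way_above s r"
  shows "r \<le> s"
proof -
  have "poset_filter {r..}"
    by (auto simp: poset_filter_def)
  then show ?thesis
    using assms by (auto simp: way_above_def)
qed

lemma way_above_antimono:
  fixes r r' s :: "'l::{conditionally_complete_lattice, order_bot}"
  assumes "way_above s r" "r' \<le> r"
  shows "way_above s r'"
  using assms by (meson order_trans way_above_def)

text \<open>Continuity makes \<open>r\<close> the infimum of the elements way above it, so a bound
  by \<open>r\<close> can be tested on those. The main upper estimates below all go through this
  approximation.\<close>

lemma le_if_way_above_le:
  fixes r a :: "'l::{conditionally_complete_lattice, order_bot}"
  assumes "continuous_poset TYPE('l)" and "\<And>s. way_above s r \<Longrightarrow> a \<le> s"
  shows "a \<le> r"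
proof -
  have "{s. way_above s r} \<noteq> {}" "Inf {s. way_above s r} = r"
    using assms(1) by (auto simp: continuous_poset_def poset_filter_def)
  then show ?thesis
    using assms(2) cInf_greatest[of "{s. way_above s r}" a] by auto
qed

subsection \<open>Borel sets\<close>

lemma sigma_algebra_borel_sets: "sigma_algebra (topspace X) (borel_sets X)"
  unfolding borel_sets_def
  by (rule sigma_algebra_sigma_sets) (auto dest: openin_subset compactin_subset_topspace)

lemma borel_sets_subset_topspace: "B \<in> borel_sets X \<Longrightarrow> B \<subseteq> topspace X"
  using sigma_algebra.axioms(1)[OF sigma_algebra_borel_sets]
  by (meson PowD algebra.axioms(1) ring_of_sets_def semiring_of_sets_def subset_class.space_closed subsetD)

lemma openin_borel_sets: "openin X G \<Longrightarrow> G \<in> borel_sets X"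
  by (auto simp: borel_sets_def)

lemma empty_borel_sets: "{} \<in> borel_sets X"
  by (simp add: openin_borel_sets)

lemma Un_borel_sets: "A \<in> borel_sets X \<Longrightarrow> B \<in> borel_sets X \<Longrightarrow> A \<union> B \<in> borel_sets X"
  by (meson ring_of_sets.Un sigma_algebra_borel_sets sigma_algebra_def algebra_def)

lemma Int_borel_sets: "A \<in> borel_sets X \<Longrightarrow> B \<in> borel_sets X \<Longrightarrow> A \<inter> B \<in> borel_sets X"
  by (meson semiring_of_sets.Int sigma_algebra_borel_sets sigma_algebra_def algebra_def ring_of_sets_def)

lemma closedin_borel_sets:
  assumes "closedin X C"
  shows "C \<in> borel_sets X"
proof -
  have "topspace X - (topspace X - C) \<in> borel_sets X"
    using assms sigma_algebra_borel_sets openin_borel_sets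
    by (metis algebra.compl_sets closedin_def sigma_algebra_def)
  then show ?thesis
    using closedin_subset[OF assms] by (simp add: double_diff)
qed

text \<open>Every open set containing \<open>a\<close> contains all of \<open>A\<close>, so one
  member of a cover already suffices.\<close>

lemma compactin_if_subset_up_point:
  assumes "A \<subseteq> topspace X" "a \<in> A" "A \<subseteq> up_point X a"
  shows "compactin X A"
  unfolding compactin_def
proof (intro conjI allI impI)
  fix \<U> assume \<U>: "Ball \<U> (openin X) \<and> A \<subseteq> \<Union>\<U>"
  then obtain U where U: "U \<in> \<U>" "a \<in> U"
    using assms(2) by auto
  then have "A \<subseteq> U"
    using assms(3) \<U> by (auto simp: up_point_def)
  then show "\<exists>\<F>. finite \<F> \<and> \<F> \<subseteq> \<U> \<and> A \<subseteq> \<Union>\<F>"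
    using U by (intro exI[of _ "{U}"]) auto
qed (use assms in auto)

lemma up_point_borel_sets:
  assumes "x \<in> topspace X"
  shows "up_point X x \<in> borel_sets X"
proof -
  have "up_point X x \<subseteq> topspace X" "x \<in> up_point X x"
    using assms by (auto simp: up_point_def)
  then have "compactin X (up_point X x)"
    by (meson compactin_if_subset_up_point order_refl)
  moreover have "saturated_in X (up_point X x)"
    unfolding saturated_in_def up_point_def
    by (rule exI[of _ "{U. openin X U \<and> x \<in> U}"]) (use assms in auto)
  ultimately show ?thesis
    by (auto simp: borel_sets_def)
qed

lemma point_class_borel_sets: "x \<in> topspace X \<Longrightarrow> point_class X x \<in> borel_sets X"
  by (simp add: point_class_def Int_borel_sets up_point_borel_sets closedin_borel_sets)

lemma self_in_point_class: "x \<in> topspace X \<Longrightarrow> x \<in> point_class X x"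
  by (auto simp: point_class_def up_point_def in_closure_of)

text \<open>An open set around \<open>y\<close> contains \<open>x\<close>, since \<open>y\<close>
  lies in the closure of \<open>x\<close>, and hence contains all of \<open>up_point X x\<close>.
  The points of a class thus share their open neighbourhoods.\<close>

lemma point_class_subset_up_point:
  assumes "y \<in> point_class X x"
  shows "point_class X x \<subseteq> up_point X y"
  using assms by (auto simp: point_class_def up_point_def in_closure_of)

text \<open>A nonempty \<open>A\<close> lies in \<open>up_point X a\<close> for each of its points
  \<open>a\<close>, which forces compactness.\<close>

lemma compact_borel_if_subset_point_class:
  assumes "A \<in> borel_sets X" "A \<subseteq> point_class X x"
  shows "A \<in> compact_borel_sets X"
proof (cases "A = {}")
  case False
  then obtain a where "a \<in> A" by auto
  then have "compactin X A"
    using assms point_class_subset_up_point[of a X x] borel_sets_subset_topspace[OF assms(1)]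
    by (intro compactin_if_subset_up_point[of A X a]) auto
  then show ?thesis
    using assms by (simp add: compact_borel_sets_def)
qed (simp add: compact_borel_sets_def empty_borel_sets)

subsection \<open>Outer and regular parts\<close>

lemma maxitive_measure_mono:
  assumes "maxitive_measure X \<nu>" "A \<in> borel_sets X" "B \<in> borel_sets X" "A \<subseteq> B"
  shows "\<nu> A \<le> \<nu> B"
proof -
  have "\<nu> B = \<nu> (A \<union> B)"
    using assms(4) by (simp add: Un_absorb1)
  also have "\<dots> = sup (\<nu> A) (\<nu> B)"
    using assms(1-3) by (simp add: maxitive_measure_def)
  finally show ?thesis
    by (metis sup_ge1)
qed

lemma outer_part_le:
  assumes "openin X G" "B \<subseteq> G"
  shows "outer_part X \<nu> B \<le> \<nu> G"
  unfolding outer_part_def using assms by (intro cINF_lower) (auto intro!: bdd_belowI[of _ bot])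

lemma outer_part_greatest:
  assumes "B \<subseteq> topspace X" and "\<And>G. openin X G \<Longrightarrow> B \<subseteq> G \<Longrightarrow> u \<le> \<nu> G"
  shows "u \<le> outer_part X \<nu> B"
  unfolding outer_part_def using assms by (intro cINF_greatest) auto

lemma outer_part_mono:
  assumes "A \<subseteq> B" "B \<subseteq> topspace X"
  shows "outer_part X \<nu> A \<le> outer_part X \<nu> B"
  using assms by (intro outer_part_greatest outer_part_le) auto

lemma outer_part_empty:
  assumes "maxitive_measure X \<nu>"
  shows "outer_part X \<nu> {} = bot"
  using outer_part_le[of X "{}" "{}" \<nu>] assms by (simp add: maxitive_measure_def bot_unique)

text \<open>The values of \<nu> on open supersets of \<open>B\<close>, closed upwards, form a filter
  whose infimum is at most the outer part; intersections of open supersets provide the lower bounds.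
  Hence \<open>s\<close> belongs to it.\<close>

lemma open_superset_if_way_above:
  assumes "maxitive_measure X \<nu>" "B \<subseteq> topspace X" "way_above s (outer_part X \<nu> B)"
  obtains G where "openin X G" "B \<subseteq> G" "\<nu> G \<le> s"
proof -
  define F where "F = {t. \<exists>G. openin X G \<and> B \<subseteq> G \<and> \<nu> G \<le> t}"
  have mem: "\<nu> G \<in> F" if "openin X G" "B \<subseteq> G" for G
    using that by (auto simp: F_def)
  have lower: "\<exists>z\<in>F. z \<le> t \<and> z \<le> t'" if tt': "t \<in> F" "t' \<in> F" for t t'
  proof -
    obtain G G' where G: "openin X G" "B \<subseteq> G" "\<nu> G \<le> t" "openin X G'" "B \<subseteq> G'" "\<nu> G' \<le> t'"
      using tt' by (auto simp: F_def)
    have "\<nu> (G \<inter> G') \<le> \<nu> G" "\<nu> (G \<inter> G') \<le> \<nu> G'"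
      using G by (auto intro!: maxitive_measure_mono[OF assms(1)] openin_borel_sets)
    then show ?thesis
      using G by (intro bexI[of _ "\<nu> (G \<inter> G')"] mem) (auto intro: order_trans)
  qed
  have "poset_filter F"
  proof (rule poset_filterI)
    show "\<nu> (topspace X) \<in> F"
      using assms(2) by (intro mem) auto
    show "t' \<in> F" if "t \<in> F" "t \<le> t'" for t t'
      using that unfolding F_def mem_Collect_eq by (meson order_trans)
  qed (rule lower)
  moreover have "Inf F \<le> outer_part X \<nu> B"
    using assms(2)
    by (intro outer_part_greatest cInf_lower mem) (auto intro!: bdd_belowI[of _ bot])
  ultimately have "s \<in> F"
    using assms(3) by (simp add: way_above_def)
  then show ?thesis
    using that by (auto simp: F_def)
qed

text \<open>An \<open>s\<close> way above the join is way above both outer parts, so open supersets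
  of \<open>A\<close> and \<open>B\<close> can be chosen separately; maxitivity bounds \<nu> on
  their union.\<close>

lemma outer_part_Un:
  fixes \<nu> :: "'e set \<Rightarrow> 'l::{conditionally_complete_lattice, order_bot}"
  assumes cont: "continuous_poset TYPE('l)" and \<nu>: "maxitive_measure X \<nu>"
    and A: "A \<subseteq> topspace X" and B: "B \<subseteq> topspace X"
  shows "outer_part X \<nu> (A \<union> B) = sup (outer_part X \<nu> A) (outer_part X \<nu> B)"
proof (rule antisym)
  show "outer_part X \<nu> (A \<union> B) \<le> sup (outer_part X \<nu> A) (outer_part X \<nu> B)"
  proof (rule le_if_way_above_le[OF cont])
    fix s assume s: "way_above s (sup (outer_part X \<nu> A) (outer_part X \<nu> B))"
    obtain G where G: "openin X G" "A \<subseteq> G" "\<nu> G \<le> s"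
      using open_superset_if_way_above[OF \<nu> A way_above_antimono[OF s sup_ge1]] .
    obtain H where H: "openin X H" "B \<subseteq> H" "\<nu> H \<le> s"
      using open_superset_if_way_above[OF \<nu> B way_above_antimono[OF s sup_ge2]] .
    have "outer_part X \<nu> (A \<union> B) \<le> \<nu> (G \<union> H)"
      using G H by (intro outer_part_le) auto
    also have "\<dots> = sup (\<nu> G) (\<nu> H)"
      using \<nu> G H by (simp add: maxitive_measure_def openin_borel_sets)
    finally show "outer_part X \<nu> (A \<union> B) \<le> s"
      using G H by (meson le_sup_iff order_trans)
  qed
qed (use A B in \<open>auto intro!: outer_part_mono\<close>)

lemma outer_part_compact_le:
  fixes \<nu> :: "'e set \<Rightarrow> 'l::{conditionally_complete_lattice, order_bot}"
  assumes cont: "continuous_poset TYPE('l)" and \<nu>: "maxitive_measure X \<nu>"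
    and K: "compactin X K" and u: "\<And>x. x \<in> K \<Longrightarrow> outer_part X \<nu> {x} \<le> u"
  shows "outer_part X \<nu> K \<le> u"
proof (rule le_if_way_above_le[OF cont])
  fix s assume s: "way_above s u"
  define \<U> where "\<U> = {G. openin X G \<and> \<nu> G \<le> s}"
  have "K \<subseteq> \<Union>\<U>"
  proof
    fix x assume x: "x \<in> K"
    then have "{x} \<subseteq> topspace X"
      using compactin_subset_topspace[OF K] by auto
    then obtain G where "openin X G" "{x} \<subseteq> G" "\<nu> G \<le> s"
      by (rule open_superset_if_way_above[OF \<nu> _ way_above_antimono[OF s u[OF x]]])
    then show "x \<in> \<Union>\<U>"
      by (auto simp: \<U>_def)
  qed
  moreover have "Ball \<U> (openin X)"
    by (simp add: \<U>_def)
  ultimately obtain \<F> where \<F>: "finite \<F>" "\<F> \<subseteq> \<U>" "K \<subseteq> \<Union>\<F>"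
    using K by (auto simp: compactin_def)
  \<comment> \<open>Maxitivity carries the bound \<open>s\<close> over to finite unions; the empty
    union has value \<open>bot\<close>.\<close>
  from \<F>(1,2) have "openin X (\<Union>\<F>) \<and> \<nu> (\<Union>\<F>) \<le> s"
  proof (induction \<F> rule: finite_induct)
    case empty
    then show ?case
      using \<nu> by (simp add: maxitive_measure_def)
  next
    case (insert G \<F>)
    then have "openin X G" "\<nu> G \<le> s" "openin X (\<Union>\<F>)" "\<nu> (\<Union>\<F>) \<le> s"
      by (auto simp: \<U>_def)
    moreover from this have "\<nu> (G \<union> \<Union>\<F>) = sup (\<nu> G) (\<nu> (\<Union>\<F>))"
      using \<nu> by (simp add: maxitive_measure_def openin_borel_sets)
    ultimately show ?case
      by (simp add: openin_Un)
  qed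
  then show "outer_part X \<nu> K \<le> s"
    using order_trans[OF outer_part_le[of X "\<Union>\<F>" K \<nu>]] \<F>(3) by blast
qed

section \<open>The regular part and its determination by point values\<close>

lemma regular_part_upper:
  assumes "B \<subseteq> topspace X" "K \<in> compact_borel_sets X" "K \<subseteq> B"
  shows "outer_part X \<nu> K \<le> regular_part X \<nu> B"
  unfolding regular_part_def using assms
  by (intro cSUP_upper) (auto intro!: bdd_aboveI[of _ "\<nu> (topspace X)"] outer_part_le)

lemma regular_part_least:
  assumes "\<And>K. K \<in> compact_borel_sets X \<Longrightarrow> K \<subseteq> B \<Longrightarrow> outer_part X \<nu> K \<le> u"
  shows "regular_part X \<nu> B \<le> u"
  unfolding regular_part_def using assms
  by (intro cSUP_least) (auto intro!: exI[of _ "{}"] simp: compact_borel_sets_def empty_borel_sets)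

lemma regular_part_mono:
  assumes "A \<subseteq> B" "B \<subseteq> topspace X"
  shows "regular_part X \<nu> A \<le> regular_part X \<nu> B"
  using assms by (intro regular_part_least regular_part_upper) auto

lemma regular_part_le_outer_part:
  assumes "B \<subseteq> topspace X"
  shows "regular_part X \<nu> B \<le> outer_part X \<nu> B"
  using assms by (intro regular_part_least outer_part_mono)

text \<open>A singleton need not be Borel, so it is replaced by the trace on \<open>B\<close> of the
  class of \<open>x\<close>, which is a compact Borel set containing \<open>x\<close>.\<close>

lemma outer_part_point_le_regular_part:
  assumes "B \<in> borel_sets X" "x \<in> B"
  shows "outer_part X \<nu> {x} \<le> regular_part X \<nu> B"
proof -
  note sub = borel_sets_subset_topspace[OF assms(1)]
  have x: "x \<in> topspace X"
    using sub assms(2) by auto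
  have "outer_part X \<nu> {x} \<le> outer_part X \<nu> (point_class X x \<inter> B)"
    using self_in_point_class[OF x] assms sub by (intro outer_part_mono) auto
  also have "\<dots> \<le> regular_part X \<nu> B"
    using sub assms point_class_borel_sets[OF x]
    by (intro regular_part_upper compact_borel_if_subset_point_class[of _ X x] Int_borel_sets) auto
  finally show ?thesis .
qed

text \<open>Compact sets are controlled by their points through
  \<open>outer_part_compact_le\<close>. Stated as an equivalence, this says that the regular part is
  the least upper bound of the point values, without writing a supremum over points.\<close>

lemma regular_part_le_iff:
  fixes \<nu> :: "'e set \<Rightarrow> 'l::{conditionally_complete_lattice, order_bot}"
  assumes "continuous_poset TYPE('l)" "maxitive_measure X \<nu>" "B \<in> borel_sets X"
  shows "regular_part X \<nu> B \<le> u \<longleftrightarrow> (\<forall>x\<in>B. outer_part X \<nu> {x} \<le> u)"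
proof
  assume "regular_part X \<nu> B \<le> u"
  then show "\<forall>x\<in>B. outer_part X \<nu> {x} \<le> u"
    by (intro ballI order_trans[OF outer_part_point_le_regular_part[OF assms(3)]])
next
  assume u: "\<forall>x\<in>B. outer_part X \<nu> {x} \<le> u"
  show "regular_part X \<nu> B \<le> u"
  proof (rule regular_part_least)
    fix K assume "K \<in> compact_borel_sets X" "K \<subseteq> B"
    then show "outer_part X \<nu> K \<le> u"
      using u outer_part_compact_le[OF assms(1,2), of K u]
      by (auto simp: compact_borel_sets_def)
  qed
qed

lemma maxitive_measure_regular_part:
  fixes \<nu> :: "'e set \<Rightarrow> 'l::{conditionally_complete_lattice, order_bot}"
  assumes "continuous_poset TYPE('l)" "maxitive_measure X \<nu>"
  shows "maxitive_measure X (regular_part X \<nu>)"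
  unfolding maxitive_measure_def
proof (intro conjI ballI)
  show "regular_part X \<nu> {} = bot"
    using regular_part_le_outer_part[of "{}" X \<nu>] outer_part_empty[OF assms(2)]
    by (simp add: bot_unique)
next
  fix A B assume AB: "A \<in> borel_sets X" "B \<in> borel_sets X"
  show "regular_part X \<nu> (A \<union> B) = sup (regular_part X \<nu> A) (regular_part X \<nu> B)"
  proof (rule antisym)
    show "regular_part X \<nu> (A \<union> B) \<le> sup (regular_part X \<nu> A) (regular_part X \<nu> B)"
      \<comment> \<open>Only point values have to be compared, and each point of the union lies in
        \<open>A\<close> or in \<open>B\<close>.\<close>
      using AB outer_part_point_le_regular_part[of _ X _ \<nu>]
      by (auto simp: regular_part_le_iff[OF assms Un_borel_sets] intro: le_supI1 le_supI2)
  qed (use AB borel_sets_subset_topspace in \<open>auto intro!: regular_part_mono\<close>)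
qed

lemma outer_part_regular_part:
  fixes \<nu> :: "'e set \<Rightarrow> 'l::{conditionally_complete_lattice, order_bot}"
  assumes cont: "continuous_poset TYPE('l)" and \<nu>: "maxitive_measure X \<nu>"
    and B: "B \<in> borel_sets X"
  shows "outer_part X (regular_part X \<nu>) B = regular_part X (regular_part X \<nu>) B"
proof (rule antisym)
  note sub = borel_sets_subset_topspace[OF B]
  show "outer_part X (regular_part X \<nu>) B \<le> regular_part X (regular_part X \<nu>) B"
  proof (rule le_if_way_above_le[OF cont])
    fix s assume s: "way_above s (regular_part X (regular_part X \<nu>) B)"
    \<comment> \<open>On this possibly infinite union \<nu> itself may exceed \<open>s\<close>. Its
      regular part cannot, because it only depends on the values at points, each of which has a
      neighbourhood with \<nu>-value at most \<open>s\<close>.\<close>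
    define U where "U = \<Union>{G. openin X G \<and> \<nu> G \<le> s}"
    have U: "openin X U"
      by (auto simp: U_def)
    have "B \<subseteq> U"
    proof
      fix x assume x: "x \<in> B"
      then have x': "{x} \<subseteq> topspace X"
        using sub by auto
      \<comment> \<open>Each open set around \<open>x\<close> has regular part at least the point
        value at \<open>x\<close>, so passing to the outer part of the regular part does not lose
        that value.\<close>
      have "outer_part X \<nu> {x} \<le> outer_part X (regular_part X \<nu>) {x}"
        using x' by (intro outer_part_greatest outer_part_point_le_regular_part openin_borel_sets) auto
      also have "\<dots> \<le> regular_part X (regular_part X \<nu>) B"
        using B x by (rule outer_part_point_le_regular_part)
      finally obtain G where "openin X G" "{x} \<subseteq> G" "\<nu> G \<le> s"
        using open_superset_if_way_above[OF \<nu> x' way_above_antimono[OF s]] by metis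
      then show "x \<in> U"
        by (auto simp: U_def)
    qed
    moreover have "outer_part X \<nu> {x} \<le> s" if x: "x \<in> U" for x
    proof -
      obtain G where G: "openin X G" "x \<in> G" "\<nu> G \<le> s"
        using x by (auto simp: U_def)
      then show ?thesis
        using outer_part_le[of X G "{x}" \<nu>] by (auto intro: order_trans)
    qed
    then have "regular_part X \<nu> U \<le> s"
      by (simp add: regular_part_le_iff[OF cont \<nu> openin_borel_sets[OF U]])
    ultimately show "outer_part X (regular_part X \<nu>) B \<le> s"
      using order_trans[OF outer_part_le[OF U]] by blast
  qed
  show "regular_part X (regular_part X \<nu>) B \<le> outer_part X (regular_part X \<nu>) B"
    using sub by (rule regular_part_le_outer_part)
qed

subsection \<open>The singular part\<close>

text \<open>Quantifying over all Borel subsets of \<open>B\<close>, and not only over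
  \<open>B\<close>, makes this set shrink as \<open>B\<close> grows, which builds monotonicity into
  its infimum.\<close>

definition singular_bounds ::
  "'e topology \<Rightarrow> ('e set \<Rightarrow> 'l::{conditionally_complete_lattice, order_bot}) \<Rightarrow> 'e set \<Rightarrow> 'l set" where
  "singular_bounds X \<nu> B =
     {t. \<forall>A\<in>borel_sets X. A \<subseteq> B \<longrightarrow> outer_part X \<nu> A \<le> sup (regular_part X \<nu> A) t}"

definition singular_part ::
  "'e topology \<Rightarrow> ('e set \<Rightarrow> 'l::{conditionally_complete_lattice, order_bot}) \<Rightarrow> 'e set \<Rightarrow> 'l" where
  "singular_part X \<nu> B = Inf (singular_bounds X \<nu> B)"

lemma singular_boundsD:
  assumes "t \<in> singular_bounds X \<nu> B" "A \<in> borel_sets X" "A \<subseteq> B"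
  shows "outer_part X \<nu> A \<le> sup (regular_part X \<nu> A) t"
  using assms by (simp add: singular_bounds_def)

lemma singular_part_lower: "t \<in> singular_bounds X \<nu> B \<Longrightarrow> singular_part X \<nu> B \<le> t"
  unfolding singular_part_def by (rule cInf_lower) (auto intro!: bdd_belowI[of _ bot])

lemma outer_part_in_singular_bounds:
  assumes "B \<subseteq> topspace X"
  shows "outer_part X \<nu> B \<in> singular_bounds X \<nu> B"
  using assms by (auto simp: singular_bounds_def intro!: le_supI2 outer_part_mono)

lemma singular_part_in_singular_bounds:
  fixes \<nu> :: "'e set \<Rightarrow> 'l::{conditionally_complete_lattice, distrib_lattice, order_bot}"
  assumes cont: "continuous_poset TYPE('l)" and B: "B \<subseteq> topspace X"
  shows "singular_part X \<nu> B \<in> singular_bounds X \<nu> B"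
proof -
  let ?D = "singular_bounds X \<nu> B"
  have upper: "t' \<in> ?D" if "t \<in> ?D" "t \<le> t'" for t t'
    unfolding singular_bounds_def
  proof (intro CollectI ballI impI)
    fix A assume "A \<in> borel_sets X" "A \<subseteq> B"
    then have "outer_part X \<nu> A \<le> sup (regular_part X \<nu> A) t"
      by (rule singular_boundsD[OF that(1)])
    also have "\<dots> \<le> sup (regular_part X \<nu> A) t'"
      using that by (intro sup_mono order_refl)
    finally show "outer_part X \<nu> A \<le> sup (regular_part X \<nu> A) t'" .
  qed
  \<comment> \<open>Distributivity enters here: the join with the regular part of \<open>A\<close>
    commutes with the binary meet.\<close>
  have lower: "inf t t' \<in> ?D" if "t \<in> ?D" "t' \<in> ?D" for t t'
    using that by (auto simp: singular_bounds_def sup_inf_distrib1)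
  have filter: "poset_filter ?D"
  proof (rule poset_filterI)
    show "\<exists>z\<in>?D. z \<le> t \<and> z \<le> t'" if "t \<in> ?D" "t' \<in> ?D" for t t'
      using lower[OF that] inf_le1 inf_le2 by (intro bexI[of _ "inf t t'"]) auto
  qed (use outer_part_in_singular_bounds[OF B] upper in auto)
  have "outer_part X \<nu> A \<le> sup (regular_part X \<nu> A) (singular_part X \<nu> B)"
    if A: "A \<in> borel_sets X" "A \<subseteq> B" for A
  proof (rule le_if_way_above_le[OF cont])
    \<comment> \<open>Such an \<open>s\<close> serves twice: being way above the infimum of the
      filter, it is itself a bound in \<open>?D\<close>; being above the regular part of
      \<open>A\<close>, it absorbs that term in the join.\<close>
    fix s assume s: "way_above s (sup (regular_part X \<nu> A) (singular_part X \<nu> B))"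
    then have "way_above s (singular_part X \<nu> B)"
      by (rule way_above_antimono) simp
    then have "s \<in> ?D"
      using filter by (simp add: way_above_def singular_part_def)
    then have "outer_part X \<nu> A \<le> sup (regular_part X \<nu> A) s"
      using A by (rule singular_boundsD)
    also have "\<dots> = s"
      using way_above_imp_le[OF s] by (simp add: sup.absorb2)
    finally show "outer_part X \<nu> A \<le> s" .
  qed
  then show ?thesis
    by (simp add: singular_bounds_def)
qed

lemma singular_part_mono:
  fixes \<nu> :: "'e set \<Rightarrow> 'l::{conditionally_complete_lattice, distrib_lattice, order_bot}"
  assumes cont: "continuous_poset TYPE('l)" and "A \<subseteq> B" "B \<subseteq> topspace X"
  shows "singular_part X \<nu> A \<le> singular_part X \<nu> B"
  using singular_part_in_singular_bounds[OF cont assms(3), of \<nu>] assms(2)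
  by (intro singular_part_lower) (auto simp: singular_bounds_def)

lemma maxitive_measure_singular_part:
  fixes \<nu> :: "'e set \<Rightarrow> 'l::{conditionally_complete_lattice, distrib_lattice, order_bot}"
  assumes cont: "continuous_poset TYPE('l)" and \<nu>: "maxitive_measure X \<nu>"
  shows "maxitive_measure X (singular_part X \<nu>)"
  unfolding maxitive_measure_def
proof (intro conjI ballI)
  show "singular_part X \<nu> {} = bot"
    using singular_part_lower[OF outer_part_in_singular_bounds[of "{}" X \<nu>]] outer_part_empty[OF \<nu>]
    by (simp add: bot_unique)
next
  fix B C assume BC: "B \<in> borel_sets X" "C \<in> borel_sets X"
  let ?\<tau> = "singular_part X \<nu>"
  note sub = borel_sets_subset_topspace
  show "?\<tau> (B \<union> C) = sup (?\<tau> B) (?\<tau> C)"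
  proof (rule antisym)
    \<comment> \<open>Enlarging the regular term from \<open>A \<inter> D\<close> to
      \<open>A\<close> gives the pieces for \<open>B\<close> and \<open>C\<close> the same term, so
      that their join collapses to the form demanded by \<open>singular_bounds\<close>.\<close>
    have piece: "outer_part X \<nu> (A \<inter> D) \<le> sup (regular_part X \<nu> A) (?\<tau> D)"
      if "A \<in> borel_sets X" "D \<in> borel_sets X" for A D
    proof -
      have "outer_part X \<nu> (A \<inter> D) \<le> sup (regular_part X \<nu> (A \<inter> D)) (?\<tau> D)"
        by (intro singular_boundsD[OF singular_part_in_singular_bounds[OF cont]] sub Int_borel_sets
            Int_lower2 that)
      moreover have "regular_part X \<nu> (A \<inter> D) \<le> regular_part X \<nu> A"
        by (rule regular_part_mono[OF Int_lower1 sub[OF that(1)]])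
      ultimately show ?thesis
        by (rule order_trans[OF _ sup_mono[OF _ order_refl]])
    qed
    show "?\<tau> (B \<union> C) \<le> sup (?\<tau> B) (?\<tau> C)"
    proof (rule singular_part_lower, unfold singular_bounds_def, intro CollectI ballI impI)
      fix A assume A: "A \<in> borel_sets X" "A \<subseteq> B \<union> C"
      then have "outer_part X \<nu> A = outer_part X \<nu> ((A \<inter> B) \<union> (A \<inter> C))"
        by (metis Int_Un_distrib Int_absorb2)
      also have "\<dots> = sup (outer_part X \<nu> (A \<inter> B)) (outer_part X \<nu> (A \<inter> C))"
        using sub[OF A(1)] by (intro outer_part_Un[OF cont \<nu>]) auto
      also have "\<dots> \<le> sup (sup (regular_part X \<nu> A) (?\<tau> B)) (sup (regular_part X \<nu> A) (?\<tau> C))"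
        using A BC by (intro sup_mono piece)
      finally show "outer_part X \<nu> A \<le> sup (regular_part X \<nu> A) (sup (?\<tau> B) (?\<tau> C))"
        by (simp add: sup.left_commute sup.assoc)
    qed
    show "sup (?\<tau> B) (?\<tau> C) \<le> ?\<tau> (B \<union> C)"
      by (intro sup_least singular_part_mono[OF cont] Un_upper1 Un_upper2 sub Un_borel_sets BC)
  qed
qed

text \<open>The decomposition is the attained bound taken at \<open>B\<close> itself. For
  minimality, a competing \<tau> is monotone, so its value at \<open>B\<close> works for every Borel
  subset of \<open>B\<close> and is a member of \<open>singular_bounds X \<nu> B\<close>.\<close>

lemma is_singular_part_singular_part:
  fixes \<nu> :: "'e set \<Rightarrow> 'l::{conditionally_complete_lattice, distrib_lattice, order_bot}"
  assumes cont: "continuous_poset TYPE('l)" and \<nu>: "maxitive_measure X \<nu>"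
  shows "is_singular_part X \<nu> (singular_part X \<nu>)"
proof -
  have "outer_part X \<nu> B = sup (regular_part X \<nu> B) (singular_part X \<nu> B)"
    if "B \<in> borel_sets X" for B
  proof (rule antisym)
    note sub = borel_sets_subset_topspace[OF that]
    show "outer_part X \<nu> B \<le> sup (regular_part X \<nu> B) (singular_part X \<nu> B)"
      using singular_part_in_singular_bounds[OF cont sub] that order_refl by (rule singular_boundsD)
    show "sup (regular_part X \<nu> B) (singular_part X \<nu> B) \<le> outer_part X \<nu> B"
      by (intro sup_least regular_part_le_outer_part singular_part_lower
          outer_part_in_singular_bounds sub)
  qed
  moreover have "singular_part X \<nu> B \<le> \<tau> B"
    if \<tau>: "singular_complement X \<nu> \<tau>" and B: "B \<in> borel_sets X" for \<tau> B
  proof (rule singular_part_lower, unfold singular_bounds_def, intro CollectI ballI impI)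
    fix A assume A: "A \<in> borel_sets X" "A \<subseteq> B"
    then have "\<tau> A \<le> \<tau> B"
      using \<tau> B maxitive_measure_mono[of X \<tau>] by (auto simp: singular_complement_def)
    then show "outer_part X \<nu> A \<le> sup (regular_part X \<nu> A) (\<tau> B)"
      using \<tau> A by (auto simp: singular_complement_def intro: le_supI2)
  qed
  ultimately show ?thesis
    using \<nu> maxitive_measure_singular_part[OF assms]
    by (simp add: is_singular_part_def singular_complement_def)
qed

text \<open>All Borel subsets of the class are compact and hence compete in their own regular part,
  so \<open>bot\<close> is already a bound.\<close>

lemma singular_part_point_class:
  assumes "x \<in> topspace X"
  shows "singular_part X \<nu> (point_class X x) = bot"
proof -
  have "bot \<in> singular_bounds X \<nu> (point_class X x)"
    by (auto simp: singular_bounds_def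
        intro!: le_supI1 regular_part_upper borel_sets_subset_topspace compact_borel_if_subset_point_class)
  then show ?thesis
    using singular_part_lower bot_unique by metis
qed

text \<open>Since the outer part of the regular part equals its own regular part, the zero measure
  solves the equation, and nothing lies below it.\<close>

lemma is_singular_part_regular_part:
  fixes \<nu> :: "'e set \<Rightarrow> 'l::{conditionally_complete_lattice, order_bot}"
  assumes "continuous_poset TYPE('l)" "maxitive_measure X \<nu>"
  shows "is_singular_part X (regular_part X \<nu>) (\<lambda>_. bot)"
  using maxitive_measure_regular_part[OF assms] outer_part_regular_part[OF assms]
  unfolding is_singular_part_def singular_complement_def
  by (auto simp: sup.absorb1) (simp add: maxitive_measure_def)

theorem theorem5p3:
  fixes X :: "'e topology"
    and \<nu> :: "'e set \<Rightarrow> 'l::{conditionally_complete_lattice, distrib_lattice, order_bot}"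
  assumes "continuous_poset TYPE('l)"
    and "quasisober X"
    and "maxitive_measure X \<nu>"
  shows "(\<exists>\<tau>. is_singular_part X \<nu> \<tau>) \<and>
    (\<forall>\<tau>. is_singular_part X \<nu> \<tau> \<longrightarrow> (\<forall>x\<in>topspace X. \<tau> (point_class X x) = bot)) \<and>
    is_singular_part X (regular_part X \<nu>) (\<lambda>_. bot)"
proof (intro conjI allI impI ballI)
  show "\<exists>\<tau>. is_singular_part X \<nu> \<tau>"
    using is_singular_part_singular_part[OF assms(1,3)] by blast
  show "is_singular_part X (regular_part X \<nu>) (\<lambda>_. bot)"
    using assms(1,3) by (rule is_singular_part_regular_part)
next
  fix \<tau> x assume \<tau>: "is_singular_part X \<nu> \<tau>" and x: "x \<in> topspace X"
  \<comment> \<open>Minimality of \<tau> against the constructed singular part transfers the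
    vanishing to any singular part.\<close>
  have "\<tau> (point_class X x) \<le> singular_part X \<nu> (point_class X x)"
    using \<tau> is_singular_part_singular_part[OF assms(1,3)] point_class_borel_sets[OF x]
    by (simp add: is_singular_part_def)
  then show "\<tau> (point_class X x) = bot"
    using singular_part_point_class[OF x] bot_unique by metis
qed

end
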